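(* Let $X$ be a lattice-ordered group and let $A, B \leq X$ be two subobjects (subalgebras) of $X$ in the category $\ell\mathbb{G}rp$ of lattice-ordered groups. Then $A$ and $B$ cooperate if and only if $B \subseteq A^{\perp}$. Therefore, $A^{\perp} \leq X$ is the centralizer of $A \leq X$. Moreover, if $A$ is an ideal of $X$, then $A^{\perp}$ is an ideal of $X$, too.
   Context: A lattice-ordered group is an algebra $(X,\cdot,e,(-)^{-1},\lor)$ such that $(X,\cdot,e,(-)^{-1})$ is a group, $(X,\lor)$ is a semilattice ($\lor$ is associative, commutative, idempotent), and $x(y\lor z)=xy\lor xz$, $(x\lor y)z=xz\lor yz$ for all $x,y,z$. Morphisms are the maps preserving the group product and $\lor$; this defines the category $\ell\mathbb{G}rp$. One sets $x\land y := (x^{-1}\lor y^{-1})^{-1}$, which makes $(X,\lor,\land)$ a distributive lattice with order $x\le y \iff x\lor y=y$. Subobjects of $X$ are the subalgebras (subgroups closed under $\lor$). For $x\in X$, $|x| := x\lor x^{-1}$. For a non-empty subset $S\subseteq X$, the polar of $S$ is $S^{\perp} := \{x\in X \mid |x|\land|s|=e \text{ for each } s\in S\}$ (it is a subalgebra of $X$). An ideal of $X$ is a subobject that is the kernel of some morphism; equivalently, a subalgebra $A$ that is normal as a subgroup and convex (if $a\le x\le b$ with $a,b\in A$, $x\in X$, then $x\in A$). Two subobjects $A,B\leq X$ cooperate if there is a morphism $\varphi\colon A\times B\to X$ of lattice-ordered groups (called cooperator, necessarily unique) with $\varphi(a,e)=a$ and $\varphi(e,b)=b$ for all $a\in A$,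 $b\in B$. The centralizer of $A$ in $X$ is the greatest subobject of $X$ that cooperates with $A$. *)

theory Defs
  imports "HOL-Algebra.Coset"
begin

record 'a lgroup = "'a monoid" +
  ljoin :: "'a \<Rightarrow> 'a \<Rightarrow> 'a" (infixl \<open>\<curlyvee>\<index>\<close> 65)

locale lattice_ordered_group = group X for X (structure) +
  assumes ljoin_closed: "\<lbrakk>x \<in> carrier X; y \<in> carrier X\<rbrakk> \<Longrightarrow> x \<curlyvee> y \<in> carrier X"
    and ljoin_assoc: "\<lbrakk>x \<in> carrier X; y \<in> carrier X; z \<in> carrier X\<rbrakk>
          \<Longrightarrow> (x \<curlyvee> y) \<curlyvee> z = x \<curlyvee> (y \<curlyvee> z)"
    and ljoin_comm: "\<lbrakk>x \<in> carrier X; y \<in> carrier X\<rbrakk> \<Longrightarrow> x \<curlyvee> y = y \<curlyvee> x"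
    and ljoin_idem: "x \<in> carrier X \<Longrightarrow> x \<curlyvee> x = x"
    and mult_ljoin_distrib: "\<lbrakk>x \<in> carrier X; y \<in> carrier X; z \<in> carrier X\<rbrakk>
          \<Longrightarrow> x \<otimes> (y \<curlyvee> z) = (x \<otimes> y) \<curlyvee> (x \<otimes> z)"
    and ljoin_mult_distrib: "\<lbrakk>x \<in> carrier X; y \<in> carrier X; z \<in> carrier X\<rbrakk>
          \<Longrightarrow> (x \<curlyvee> y) \<otimes> z = (x \<otimes> z) \<curlyvee> (y \<otimes> z)"

definition lmeet :: "('a, 'm) lgroup_scheme \<Rightarrow> 'a \<Rightarrow> 'a \<Rightarrow> 'a" (infixl \<open>\<curlywedge>\<index>\<close> 70)
  where "x \<curlywedge>\<^bsub>X\<^esub> y = inv\<^bsub>X\<^esub> ((inv\<^bsub>X\<^esub> x) \<curlyvee>\<^bsub>X\<^esub> (inv\<^bsub>X\<^esub> y))"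

definition labs :: "('a, 'm) lgroup_scheme \<Rightarrow> 'a \<Rightarrow> 'a"
  where "labs X x = x \<curlyvee>\<^bsub>X\<^esub> inv\<^bsub>X\<^esub> x"

definition polar :: "('a, 'm) lgroup_scheme \<Rightarrow> 'a set \<Rightarrow> 'a set"
  where "polar X S = {x \<in> carrier X. \<forall>s\<in>S. labs X x \<curlywedge>\<^bsub>X\<^esub> labs X s = \<one>\<^bsub>X\<^esub>}"

definition lhom :: "('a, 'm) lgroup_scheme \<Rightarrow> ('b, 'n) lgroup_scheme \<Rightarrow> ('a \<Rightarrow> 'b) set"
  where "lhom X Y = {h \<in> hom X Y.
    \<forall>x\<in>carrier X. \<forall>y\<in>carrier X. h (x \<curlyvee>\<^bsub>X\<^esub> y) = h x \<curlyvee>\<^bsub>Y\<^esub> h y}"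

definition subalgebra :: "'a set \<Rightarrow> ('a, 'm) lgroup_scheme \<Rightarrow> bool"
  where "subalgebra A X \<longleftrightarrow> subgroup A X \<and> (\<forall>x\<in>A. \<forall>y\<in>A. x \<curlyvee>\<^bsub>X\<^esub> y \<in> A)"

definition lprod :: "('a, 'm) lgroup_scheme \<Rightarrow> ('b, 'n) lgroup_scheme \<Rightarrow> ('a \<times> 'b) lgroup"
  where "lprod X Y = monoid.extend (X \<times>\<times> Y)
    (lgroup.fields (\<lambda>(x, y) (x', y'). (x \<curlyvee>\<^bsub>X\<^esub> x', y \<curlyvee>\<^bsub>Y\<^esub> y')))"

definition cooperate :: "('a, 'm) lgroup_scheme \<Rightarrow> 'a set \<Rightarrow> 'a set \<Rightarrow> bool"
  where "cooperate X A B \<longleftrightarrow>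
    (\<exists>\<phi> \<in> lhom (lprod (X\<lparr>carrier := A\<rparr>) (X\<lparr>carrier := B\<rparr>)) X.
       (\<forall>a\<in>A. \<phi> (a, \<one>\<^bsub>X\<^esub>) = a) \<and> (\<forall>b\<in>B. \<phi> (\<one>\<^bsub>X\<^esub>, b) = b))"

definition is_centralizer :: "('a, 'm) lgroup_scheme \<Rightarrow> 'a set \<Rightarrow> 'a set \<Rightarrow> bool"
  where "is_centralizer X A C \<longleftrightarrow> subalgebra C X \<and> cooperate X A C \<and>
    (\<forall>B. subalgebra B X \<and> cooperate X A B \<longrightarrow> B \<subseteq> C)"

text \<open>An existential quantifier cannot range over the type of the codomain, so ideals are
  defined as kernels of morphisms into algebras carried by \<^typ>\<open>'a set\<close>. This is no
  restriction: see \<open>l_ideal_kernel\<close> below.\<close>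

definition l_ideal :: "'a set \<Rightarrow> ('a, 'm) lgroup_scheme \<Rightarrow> bool"
  where "l_ideal A X \<longleftrightarrow> subalgebra A X \<and>
    (\<exists>(Y :: 'a set lgroup) h. lattice_ordered_group Y \<and> h \<in> lhom X Y \<and> A = kernel X Y h)"

lemma l_ideal_kernel:
  fixes X :: "('a, 'm) lgroup_scheme" and Y :: "('b, 'n) lgroup_scheme"
  assumes X: "lattice_ordered_group X" and Y: "lattice_ordered_group Y" and h: "h \<in> lhom X Y"
  shows "l_ideal (kernel X Y h) X"
proof -
  interpret X: lattice_ordered_group X by fact
  interpret Y: lattice_ordered_group Y by fact
  have hom: "h \<in> hom X Y"
    and hj: "\<And>x y. \<lbrakk>x \<in> carrier X; y \<in> carrier X\<rbrakk> \<Longrightarrow> h (x \<curlyvee>\<^bsub>X\<^esub> y) = h x \<curlyvee>\<^bsub>Y\<^esub> h y"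
    using h by (auto simp: lhom_def)
  interpret h: group_hom X Y h by unfold_locales (fact hom)
  have sub: "subalgebra (kernel X Y h) X"
    unfolding subalgebra_def using h.subgroup_kernel
    by (auto simp: kernel_def X.ljoin_closed hj Y.ljoin_idem)
  define f where "f y = {x \<in> carrier X. h x = y}" for y
  define r where "r S = h (SOME x. x \<in> S)" for S
  have r: "r (f (h x)) = h x" if "x \<in> carrier X" for x
    using that someI[of "\<lambda>z. z \<in> f (h x)" x] by (auto simp: f_def r_def)
  define Q :: "'a set lgroup" where "Q = \<lparr>carrier = (\<lambda>x. f (h x)) ` carrier X,
    mult = (\<lambda>S T. f (r S \<otimes>\<^bsub>Y\<^esub> r T)), one = f \<one>\<^bsub>Y\<^esub>, ljoin = (\<lambda>S T. f (r S \<curlyvee>\<^bsub>Y\<^esub> r T))\<rparr>"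
  have carr: "carrier Q = (\<lambda>x. f (h x)) ` carrier X" by (simp add: Q_def)
  have one: "\<one>\<^bsub>Q\<^esub> = f (h \<one>\<^bsub>X\<^esub>)" by (simp add: Q_def)
  have mult: "f (h x) \<otimes>\<^bsub>Q\<^esub> f (h y) = f (h (x \<otimes>\<^bsub>X\<^esub> y))"
    if "x \<in> carrier X" "y \<in> carrier X" for x y
    using that by (simp add: Q_def r)
  have join: "f (h x) \<curlyvee>\<^bsub>Q\<^esub> f (h y) = f (h (x \<curlyvee>\<^bsub>X\<^esub> y))"
    if "x \<in> carrier X" "y \<in> carrier X" for x y
    using that by (simp add: Q_def r hj)
  have "group Q"
  proof (rule groupI)
    fix S assume "S \<in> carrier Q"
    then obtain x where x: "x \<in> carrier X" "S = f (h x)" by (auto simp: carr)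
    have "f (h (inv\<^bsub>X\<^esub> x)) \<otimes>\<^bsub>Q\<^esub> S = \<one>\<^bsub>Q\<^esub>"
      using x(1) unfolding x(2) by (subst mult) (simp_all only: one X.l_inv X.inv_closed)
    moreover have "f (h (inv\<^bsub>X\<^esub> x)) \<in> carrier Q" using x X.inv_closed by (auto simp only: carr)
    ultimately show "\<exists>y\<in>carrier Q. y \<otimes>\<^bsub>Q\<^esub> S = \<one>\<^bsub>Q\<^esub>" by blast
  qed (auto simp only: carr one mult X.m_closed X.one_closed X.m_assoc X.l_one)
  moreover have "S \<curlyvee>\<^bsub>Q\<^esub> T = T \<curlyvee>\<^bsub>Q\<^esub> S" if "S \<in> carrier Q" "T \<in> carrier Q" for S T
    using that X.ljoin_comm by (auto simp only: carr join)
  ultimately have "lattice_ordered_group Q"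
    unfolding lattice_ordered_group_def lattice_ordered_group_axioms_def
    by (auto simp only: carr mult join X.m_closed X.ljoin_closed X.ljoin_assoc X.ljoin_idem
        X.mult_ljoin_distrib X.ljoin_mult_distrib)
  moreover have "(\<lambda>x. f (h x)) \<in> lhom X Q"
    by (auto simp only: lhom_def hom_def mem_Collect_eq Pi_iff carr mult join)
  moreover have "kernel X Y h = kernel X Q (\<lambda>x. f (h x))"
    unfolding kernel_def one by (auto simp: f_def)
  ultimately show ?thesis using sub unfolding l_ideal_def by blast
qed

end

theory Submission
  imports Defs
begin

text \<open>If $|a| \wedge |b| = e$ for all $a \in A$, $b \in B$, then the positive and negative parts
  of $a$ and $b$ are pairwise disjoint, so they commute and their products are joins; this makes
  $(a, b) \mapsto ab$ a morphism. Conversely, a cooperator sends $(|a|, e) \wedge (e, |b|) = (e, e)$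
  to $|a| \wedge |b|$. If $A$ is normal, so is $A^{\perp}$; it is always convex, and a convex normal
  subalgebra is the kernel of the projection onto its cosets, on which the join is well defined.\<close>

context lattice_ordered_group
begin

section \<open>The order, with products and inverses\<close>

definition le (infix \<open>\<preceq>\<close> 50)
  where "x \<preceq> y \<longleftrightarrow> x \<curlyvee> y = y"

declare ljoin_closed [simp, intro]

lemma le_refl [simp]: "x \<in> carrier X \<Longrightarrow> x \<preceq> x"
  by (simp add: le_def ljoin_idem)

lemma le_trans:
  assumes "x \<preceq> y" "y \<preceq> z" and "x \<in> carrier X" "y \<in> carrier X" "z \<in> carrier X"
  shows "x \<preceq> z"
  using assms ljoin_assoc[of x y z] by (simp add: le_def)

lemma le_antisym:
  assumes "x \<preceq> y" "y \<preceq> x" and "x \<in> carrier X" "y \<in> carrier X"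
  shows "x = y"
  using assms ljoin_comm[of x y] by (simp add: le_def)

lemma ljoin_ge1 [simp]:
  assumes "x \<in> carrier X" "y \<in> carrier X"
  shows "x \<preceq> x \<curlyvee> y"
  using assms ljoin_assoc[of x x y] by (simp add: le_def ljoin_idem)

lemma ljoin_ge2 [simp]:
  assumes "x \<in> carrier X" "y \<in> carrier X"
  shows "y \<preceq> x \<curlyvee> y"
  using assms ljoin_ge1[of y x] by (simp add: ljoin_comm)

lemma ljoin_least:
  assumes "x \<preceq> z" "y \<preceq> z" and "x \<in> carrier X" "y \<in> carrier X" "z \<in> carrier X"
  shows "x \<curlyvee> y \<preceq> z"
  using assms ljoin_assoc[of x y z] by (simp add: le_def)

lemma mult_le_mono_left:
  assumes "x \<preceq> y" and "x \<in> carrier X" "y \<in> carrier X" "z \<in> carrier X"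
  shows "z \<otimes> x \<preceq> z \<otimes> y"
  using assms mult_ljoin_distrib[of z x y] by (simp add: le_def)

lemma mult_le_mono_right:
  assumes "x \<preceq> y" and "x \<in> carrier X" "y \<in> carrier X" "z \<in> carrier X"
  shows "x \<otimes> z \<preceq> y \<otimes> z"
  using assms ljoin_mult_distrib[of x y z] by (simp add: le_def)

lemma mult_le_mono:
  assumes "x \<preceq> y" "u \<preceq> v"
    and c: "x \<in> carrier X" "y \<in> carrier X" "u \<in> carrier X" "v \<in> carrier X"
  shows "x \<otimes> u \<preceq> y \<otimes> v"
  using le_trans[OF mult_le_mono_right[OF assms(1), of u] mult_le_mono_left[OF assms(2), of y]] c
  by simp

lemma le_mult_left:
  assumes "\<one> \<preceq> x" and "x \<in> carrier X" "y \<in> carrier X"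
  shows "y \<preceq> x \<otimes> y"
  using mult_le_mono_right[OF assms(1), of y] assms by simp

lemma le_mult_right:
  assumes "\<one> \<preceq> x" and "x \<in> carrier X" "y \<in> carrier X"
  shows "y \<preceq> y \<otimes> x"
  using mult_le_mono_left[OF assms(1), of y] assms by simp

text \<open>Multiplying \<open>x \<preceq> y\<close> by \<open>inv y\<close> on the left and
  \<open>inv x\<close> on the right leaves the inverses in reversed order.\<close>

lemma inv_le_mono:
  assumes "x \<preceq> y" and c: "x \<in> carrier X" "y \<in> carrier X"
  shows "inv y \<preceq> inv x"
proof -
  have "inv y \<otimes> x \<otimes> inv x \<preceq> inv y \<otimes> y \<otimes> inv x"
    by (intro mult_le_mono_right mult_le_mono_left) (use assms in auto)
  then show ?thesis using c by (simp add: m_assoc)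
qed

section \<open>Meets and distributivity of products over them\<close>

lemma lmeet_closed [simp, intro]:
  "\<lbrakk>x \<in> carrier X; y \<in> carrier X\<rbrakk> \<Longrightarrow> x \<curlywedge> y \<in> carrier X"
  by (simp add: lmeet_def)

lemma lmeet_comm: "\<lbrakk>x \<in> carrier X; y \<in> carrier X\<rbrakk> \<Longrightarrow> x \<curlywedge> y = y \<curlywedge> x"
  by (simp add: lmeet_def ljoin_comm)

lemma lmeet_le1 [simp]:
  assumes "x \<in> carrier X" "y \<in> carrier X"
  shows "x \<curlywedge> y \<preceq> x"
  using inv_le_mono[OF ljoin_ge1[of "inv x" "inv y"]] assms by (simp add: lmeet_def)

lemma lmeet_le2 [simp]:
  assumes "x \<in> carrier X" "y \<in> carrier X"
  shows "x \<curlywedge> y \<preceq> y"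
  using inv_le_mono[OF ljoin_ge2[of "inv x" "inv y"]] assms by (simp add: lmeet_def)

lemma lmeet_greatest:
  assumes "z \<preceq> x" "z \<preceq> y" and c: "x \<in> carrier X" "y \<in> carrier X" "z \<in> carrier X"
  shows "z \<preceq> x \<curlywedge> y"
proof -
  have "inv x \<curlyvee> inv y \<preceq> inv z"
    using assms by (intro ljoin_least inv_le_mono) auto
  from inv_le_mono[OF this] show ?thesis using c by (simp add: lmeet_def)
qed

lemma lmeet_absorb:
  assumes "x \<preceq> y" and "x \<in> carrier X" "y \<in> carrier X"
  shows "x \<curlywedge> y = x"
  using assms by (intro le_antisym lmeet_le1 lmeet_greatest) auto

lemma lmeet_mono:
  assumes "x \<preceq> u" "y \<preceq> v"
    and c: "x \<in> carrier X" "y \<in> carrier X" "u \<in> carrier X" "v \<in> carrier X"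
  shows "x \<curlywedge> y \<preceq> u \<curlywedge> v"
  using c le_trans[OF lmeet_le1[of x y] assms(1)] le_trans[OF lmeet_le2[of x y] assms(2)]
  by (intro lmeet_greatest) auto

text \<open>Inversion turns meets into joins and reverses products, so this law comes from the
  distributivity of joins on the other side.\<close>

lemma mult_lmeet_distrib:
  assumes "x \<in> carrier X" "y \<in> carrier X" "z \<in> carrier X"
  shows "x \<otimes> (y \<curlywedge> z) = (x \<otimes> y) \<curlywedge> (x \<otimes> z)"
proof -
  have "inv ((inv y \<curlyvee> inv z) \<otimes> inv x) = inv ((inv y \<otimes> inv x) \<curlyvee> (inv z \<otimes> inv x))"
    using assms by (simp add: ljoin_mult_distrib)
  then show ?thesis using assms by (simp add: lmeet_def inv_mult_group)
qed

lemma lmeet_mult_distrib: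
  assumes "x \<in> carrier X" "y \<in> carrier X" "z \<in> carrier X"
  shows "(y \<curlywedge> z) \<otimes> x = (y \<otimes> x) \<curlywedge> (z \<otimes> x)"
proof -
  have "inv (inv x \<otimes> (inv y \<curlyvee> inv z)) = inv ((inv x \<otimes> inv y) \<curlyvee> (inv x \<otimes> inv z))"
    using assms by (simp add: mult_ljoin_distrib)
  then show ?thesis using assms by (simp add: lmeet_def inv_mult_group)
qed

section \<open>Absolute values\<close>

lemma labs_closed [simp, intro]: "x \<in> carrier X \<Longrightarrow> labs X x \<in> carrier X"
  by (simp add: labs_def)

lemma labs_inv [simp]: "x \<in> carrier X \<Longrightarrow> labs X (inv x) = labs X x"
  by (simp add: labs_def ljoin_comm)

lemma labs_one [simp]: "labs X \<one> = \<one>"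
  by (simp add: labs_def ljoin_idem)

lemma le_labs [simp]: "x \<in> carrier X \<Longrightarrow> x \<preceq> labs X x"
  by (simp add: labs_def)

lemma inv_le_labs [simp]: "x \<in> carrier X \<Longrightarrow> inv x \<preceq> labs X x"
  by (simp add: labs_def)

text \<open>For \<open>m = y \<curlywedge> \<one>\<close>, the product \<open>m \<otimes> m\<close>
  expands to the meet of \<open>y \<otimes> y\<close>, \<open>y\<close> and \<open>\<one>\<close>.
  The hypothesis puts \<open>m\<close> below all three, so \<open>m \<preceq> m \<otimes> m\<close>;
  cancelling gives \<open>\<one> \<preceq> m\<close>, and \<open>m \<preceq> y\<close>.\<close>

lemma one_le_if_square:
  assumes y: "y \<in> carrier X" and sq: "\<one> \<preceq> y \<otimes> y"
  shows "\<one> \<preceq> y"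
proof -
  let ?m = "y \<curlywedge> \<one>"
  have c: "?m \<in> carrier X" using y by simp
  have "?m \<preceq> y \<otimes> y" using le_trans[OF lmeet_le2[of y \<one>] sq] y by simp
  then have "?m \<preceq> (y \<otimes> y) \<curlywedge> y" "?m \<preceq> y \<curlywedge> \<one>"
    using y by (auto intro!: lmeet_greatest)
  then have "?m \<preceq> ((y \<otimes> y) \<curlywedge> y) \<curlywedge> (y \<curlywedge> \<one>)"
    using y by (auto intro!: lmeet_greatest)
  also have "((y \<otimes> y) \<curlywedge> y) \<curlywedge> (y \<curlywedge> \<one>) = ?m \<otimes> ?m"
    using y by (simp add: lmeet_mult_distrib mult_lmeet_distrib)
  finally have "inv ?m \<otimes> ?m \<preceq> inv ?m \<otimes> (?m \<otimes> ?m)"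
    using c by (intro mult_le_mono_left) auto
  then have "\<one> \<preceq> ?m" using c by (simp flip: m_assoc)
  then show ?thesis using le_trans[OF _ lmeet_le1[of y \<one>]] y by simp
qed

text \<open>Both \<open>x\<close> and \<open>inv x\<close> lie below \<open>labs X x\<close>, so
  their product \<open>\<one>\<close> lies below its square.\<close>

lemma one_le_labs [simp]:
  assumes "x \<in> carrier X"
  shows "\<one> \<preceq> labs X x"
proof (rule one_le_if_square)
  have "x \<otimes> inv x \<preceq> labs X x \<otimes> labs X x"
    by (intro mult_le_mono) (use assms in auto)
  then show "\<one> \<preceq> labs X x \<otimes> labs X x" using assms by simp
qed (use assms in simp)

lemma labs_le:
  assumes "x \<preceq> t" "inv x \<preceq> t" "x \<in> carrier X" "t \<in> carrier X"
  shows "labs X x \<preceq> t"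
  using assms by (simp add: labs_def ljoin_least)

lemma labs_conj:
  assumes "g \<in> carrier X" "x \<in> carrier X"
  shows "labs X (g \<otimes> x \<otimes> inv g) = g \<otimes> labs X x \<otimes> inv g"
  using assms
  by (simp add: labs_def inv_mult_group m_assoc mult_ljoin_distrib ljoin_mult_distrib)

text \<open>Since \<open>inv (x \<otimes> y) = inv y \<otimes> inv x\<close> has its factors in the
  opposite order, \<open>labs X x\<close> stands on both sides of \<open>labs X y\<close>. This
  bounds both orders at once, the spare factor being at least \<open>\<one>\<close>.\<close>

lemma labs_of_mult_le:
  assumes c: "x \<in> carrier X" "y \<in> carrier X"
  shows "labs X (x \<otimes> y) \<preceq> labs X x \<otimes> labs X y \<otimes> labs X x"
proof (rule labs_le)
  have "x \<otimes> y \<otimes> \<one> \<preceq> labs X x \<otimes> labs X y \<otimes> labs X x"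
    by (intro mult_le_mono) (use c in auto)
  then show "x \<otimes> y \<preceq> labs X x \<otimes> labs X y \<otimes> labs X x" using c by simp
  have "\<one> \<otimes> inv y \<otimes> inv x \<preceq> labs X x \<otimes> labs X y \<otimes> labs X x"
    by (intro mult_le_mono) (use c in auto)
  then show "inv (x \<otimes> y) \<preceq> labs X x \<otimes> labs X y \<otimes> labs X x"
    using c by (simp add: inv_mult_group)
qed (use c in auto)

section \<open>Disjoint elements\<close>

lemma disjoint_mono:
  assumes "u \<curlywedge> v = \<one>" "\<one> \<preceq> u'" "\<one> \<preceq> v'" "u' \<preceq> u" "v' \<preceq> v"
    and "u \<in> carrier X" "v \<in> carrier X" "u' \<in> carrier X" "v' \<in> carrier X"
  shows "u' \<curlywedge> v' = \<one>"
proof (rule le_antisym)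
  show "u' \<curlywedge> v' \<preceq> \<one>" using lmeet_mono[of u' u v' v] assms by simp
qed (use assms in \<open>auto intro: lmeet_greatest\<close>)

text \<open>The product \<open>(u \<curlywedge> s) \<otimes> (v \<curlywedge> s)\<close>, which is
  \<open>\<one>\<close>, expands to the meet of \<open>u \<otimes> v\<close>,
  \<open>s \<otimes> v\<close>, \<open>u \<otimes> s\<close> and \<open>s \<otimes> s\<close>. As
  \<open>u\<close>, \<open>v\<close>, \<open>s\<close> are at least \<open>\<one>\<close>, each of
  these lies above \<open>(u \<otimes> v) \<curlywedge> s\<close>.\<close>

lemma disjoint_mult:
  assumes "u \<curlywedge> s = \<one>" "v \<curlywedge> s = \<one>" and pos: "\<one> \<preceq> u" "\<one> \<preceq> v" "\<one> \<preceq> s"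
    and c: "u \<in> carrier X" "v \<in> carrier X" "s \<in> carrier X"
  shows "(u \<otimes> v) \<curlywedge> s = \<one>"
proof (rule le_antisym)
  let ?m = "(u \<otimes> v) \<curlywedge> s"
  have m: "?m \<preceq> u \<otimes> v" "?m \<preceq> s" using c by auto
  have "s \<preceq> u \<otimes> s" "s \<preceq> s \<otimes> v" "s \<preceq> s \<otimes> s"
    using pos c le_mult_left le_mult_right by auto
  then have "?m \<preceq> u \<otimes> s" "?m \<preceq> s \<otimes> v" "?m \<preceq> s \<otimes> s"
    using le_trans[OF m(2)] c by auto
  with m have "?m \<preceq> ((u \<otimes> v) \<curlywedge> (s \<otimes> v)) \<curlywedge> ((u \<otimes> s) \<curlywedge> (s \<otimes> s))"
    using c by (auto intro!: lmeet_greatest)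
  also have "\<dots> = (u \<curlywedge> s) \<otimes> (v \<curlywedge> s)"
    using c by (simp add: lmeet_mult_distrib mult_lmeet_distrib)
  finally show "?m \<preceq> \<one>" using assms by simp
  have "\<one> \<preceq> u \<otimes> v"
    using le_trans[OF pos(2) le_mult_left[OF pos(1)]] c by simp
  then show "\<one> \<preceq> ?m" using pos c by (intro lmeet_greatest) auto
qed (use c in auto)

text \<open>By the definition of the meet, disjointness says
  \<open>inv u \<curlyvee> inv v = \<one>\<close>. Inserting this join between \<open>u\<close> and
  \<open>v\<close> and distributing leaves \<open>v \<curlyvee> u\<close>.\<close>

lemma disjoint_mult_eq_ljoin:
  assumes "u \<curlywedge> v = \<one>" and c: "u \<in> carrier X" "v \<in> carrier X"
  shows "u \<otimes> v = u \<curlyvee> v"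
proof -
  have "inv u \<curlyvee> inv v = \<one>"
    using assms by (simp add: lmeet_def inv_eq_1_iff)
  then have "u \<otimes> v = u \<otimes> (inv u \<curlyvee> inv v) \<otimes> v" using c by simp
  also have "\<dots> = v \<curlyvee> u"
    using c by (simp add: mult_ljoin_distrib ljoin_mult_distrib m_assoc)
  finally show ?thesis using c by (simp add: ljoin_comm)
qed

lemma disjoint_commute:
  assumes "u \<curlywedge> v = \<one>" and c: "u \<in> carrier X" "v \<in> carrier X"
  shows "u \<otimes> v = v \<otimes> u"
  using disjoint_mult_eq_ljoin[of u v] disjoint_mult_eq_ljoin[of v u] assms
  by (simp add: ljoin_comm lmeet_comm)

section \<open>Positive parts and orthogonal elements\<close>

text \<open>The positive part. As \<open>inv (lpos (inv x))\<close> is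
  \<open>x \<curlywedge> \<one>\<close>, the same operation also yields the negative part.\<close>

definition lpos :: "'a \<Rightarrow> 'a"
  where "lpos x = x \<curlyvee> \<one>"

lemma lpos_closed [simp, intro]: "x \<in> carrier X \<Longrightarrow> lpos x \<in> carrier X"
  by (simp add: lpos_def)

text \<open>Positive parts lie between \<open>\<one>\<close> and the absolute values, and
  disjointness passes down to smaller elements above \<open>\<one>\<close>.\<close>

lemma lpos_disjoint:
  assumes "labs X a \<curlywedge> labs X b = \<one>" "a \<in> carrier X" "b \<in> carrier X"
  shows "lpos a \<curlywedge> lpos b = \<one>"
  using assms
  by (intro disjoint_mono[OF assms(1)]) (auto simp: lpos_def intro!: ljoin_least)

lemma lpos_decomp:
  assumes "x \<in> carrier X"
  shows "lpos x \<otimes> inv (lpos (inv x)) = x"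
proof -
  have "lpos x = x \<otimes> lpos (inv x)"
    using assms by (simp add: lpos_def mult_ljoin_distrib ljoin_comm)
  then show ?thesis using assms by (simp add: m_assoc)
qed

lemma commute_inv:
  assumes "x \<otimes> y = y \<otimes> x" and c: "x \<in> carrier X" "y \<in> carrier X"
  shows "x \<otimes> inv y = inv y \<otimes> x"
proof -
  have "inv y \<otimes> (x \<otimes> y) \<otimes> inv y = inv y \<otimes> (y \<otimes> x) \<otimes> inv y"
    using assms by simp
  then have "inv y \<otimes> x = inv y \<otimes> (y \<otimes> x) \<otimes> inv y" using c by (simp add: m_assoc)
  then show ?thesis using c by (simp add: m_assoc[symmetric])
qed

lemma commute_mult:
  assumes "x \<otimes> y = y \<otimes> x" "x \<otimes> z = z \<otimes> x"
    and c: "x \<in> carrier X" "y \<in> carrier X" "z \<in> carrier X"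
  shows "x \<otimes> (y \<otimes> z) = (y \<otimes> z) \<otimes> x"
  using assms by (metis m_assoc)

text \<open>Positive parts are disjoint and hence commute; \<open>lpos_decomp\<close> carries this
  over to the elements themselves, first in \<open>b\<close>, then in \<open>a\<close>.\<close>

lemma orthogonal_commute:
  assumes o: "labs X a \<curlywedge> labs X b = \<one>" and c: "a \<in> carrier X" "b \<in> carrier X"
  shows "a \<otimes> b = b \<otimes> a"
proof -
  \<comment> \<open>The inner \<open>a\<close> is arbitrary because this is applied to both
    \<open>a\<close> and \<open>inv a\<close>, which have the same absolute value.\<close>
  have pos: "lpos a \<otimes> b = b \<otimes> lpos a"
    if "labs X a \<curlywedge> labs X b = \<one>" "a \<in> carrier X" for a
  proof -
    have "lpos a \<otimes> lpos b = lpos b \<otimes> lpos a"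
         "lpos a \<otimes> lpos (inv b) = lpos (inv b) \<otimes> lpos a"
      using that c lpos_disjoint[of a b] lpos_disjoint[of a "inv b"]
      by (auto intro!: disjoint_commute)
    then have "lpos a \<otimes> (lpos b \<otimes> inv (lpos (inv b)))
             = (lpos b \<otimes> inv (lpos (inv b))) \<otimes> lpos a"
      using that c by (intro commute_mult commute_inv) auto
    then show ?thesis using c by (simp add: lpos_decomp)
  qed
  have "b \<otimes> lpos a = lpos a \<otimes> b" "b \<otimes> lpos (inv a) = lpos (inv a) \<otimes> b"
    using pos[of a] pos[of "inv a"] o c by auto
  then have "b \<otimes> (lpos a \<otimes> inv (lpos (inv a))) = (lpos a \<otimes> inv (lpos (inv a))) \<otimes> b"
    using c by (intro commute_mult commute_inv) auto
  then show ?thesis using c by (simp add: lpos_decomp)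
qed

text \<open>The left side is the join of \<open>c\<close>, \<open>d\<close> and
  \<open>\<one>\<close>. The positive parts of \<open>inv c\<close> and \<open>inv d\<close> are
  disjoint, so the negative parts of \<open>c\<close> and \<open>d\<close> have join
  \<open>\<one>\<close>. Hence \<open>\<one> \<preceq> c \<curlyvee> d\<close>, and the extra
  \<open>\<one>\<close> is absorbed.\<close>

lemma orthogonal_ljoin:
  assumes o: "labs X c \<curlywedge> labs X d = \<one>" and c: "c \<in> carrier X" "d \<in> carrier X"
  shows "lpos c \<otimes> lpos d = c \<curlyvee> d"
proof (rule le_antisym)
  have "inv (lpos (inv c)) \<preceq> c" "inv (lpos (inv d)) \<preceq> d"
    using inv_le_mono[OF ljoin_ge1[of "inv c" \<one>]] inv_le_mono[OF ljoin_ge1[of "inv d" \<one>]] c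
    by (auto simp: lpos_def)
  then have "inv (lpos (inv c)) \<curlyvee> inv (lpos (inv d)) \<preceq> c \<curlyvee> d"
    using c le_trans[OF _ ljoin_ge1[of c d]] le_trans[OF _ ljoin_ge2[of c d]]
    by (intro ljoin_least) auto
  moreover have "lpos (inv c) \<curlywedge> lpos (inv d) = \<one>"
    using o c by (intro lpos_disjoint) auto
  then have "inv (lpos (inv c)) \<curlyvee> inv (lpos (inv d)) = \<one>"
    using c by (simp add: lmeet_def inv_eq_1_iff)
  ultimately have one: "\<one> \<preceq> c \<curlyvee> d" by simp
  have eq: "lpos c \<otimes> lpos d = lpos c \<curlyvee> lpos d"
    using o c by (intro disjoint_mult_eq_ljoin lpos_disjoint) auto
  show "lpos c \<otimes> lpos d \<preceq> c \<curlyvee> d"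
    unfolding eq unfolding lpos_def using one c by (intro ljoin_least) auto
  show "c \<curlyvee> d \<preceq> lpos c \<otimes> lpos d"
    unfolding eq unfolding lpos_def
    using c le_trans[OF ljoin_ge1[of c \<one>] ljoin_ge1[of "c \<curlyvee> \<one>" "d \<curlyvee> \<one>"]]
      le_trans[OF ljoin_ge1[of d \<one>] ljoin_ge2[of "c \<curlyvee> \<one>" "d \<curlyvee> \<one>"]]
    by (intro ljoin_least) auto
qed (use c in auto)

section \<open>Cooperation and orthogonality\<close>

lemma subalgebra_subset: "subalgebra A X \<Longrightarrow> A \<subseteq> carrier X"
  by (simp add: subalgebra_def subgroup.subset)

lemma subalgebra_labs: "subalgebra A X \<Longrightarrow> a \<in> A \<Longrightarrow> labs X a \<in> A"
  by (simp add: subalgebra_def labs_def subgroup.m_inv_closed)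

lemma cooperate_if_orthogonal:
  assumes A: "subalgebra A X" and B: "subalgebra B X"
    and orth: "\<And>a b. \<lbrakk>a \<in> A; b \<in> B\<rbrakk> \<Longrightarrow> labs X a \<curlywedge> labs X b = \<one>"
  shows "cooperate X A B"
proof -
  interpret A: subgroup A X using A by (simp add: subalgebra_def)
  interpret B: subgroup B X using B by (simp add: subalgebra_def)
  have comm: "a \<otimes> b = b \<otimes> a" if "a \<in> A" "b \<in> B" for a b
    using that orth by (intro orthogonal_commute) auto
  let ?f = "\<lambda>(a, b). a \<otimes> b"
  have mult: "(a \<otimes> a') \<otimes> (b \<otimes> b') = (a \<otimes> b) \<otimes> (a' \<otimes> b')"
    if "a \<in> A" "a' \<in> A" "b \<in> B" "b' \<in> B" for a b a' b'
  proof -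
    have "a' \<otimes> (b \<otimes> b') = b \<otimes> (a' \<otimes> b')"
      using that comm[of a' b] by (simp flip: m_assoc)
    then show ?thesis using that by (simp add: m_assoc)
  qed
  have join: "(a \<curlyvee> a') \<otimes> (b \<curlyvee> b') = (a \<otimes> b) \<curlyvee> (a' \<otimes> b')"
    if m: "a \<in> A" "a' \<in> A" "b \<in> B" "b' \<in> B" for a b a' b'
  proof -
    \<comment> \<open>Factoring \<open>a'\<close> out on the left and \<open>b\<close> on the right
      makes the two positive parts adjacent. With this mixed choice, translating back turns
      \<open>?c\<close> into \<open>a \<otimes> b\<close> and \<open>?d\<close> into
      \<open>a' \<otimes> b'\<close>.\<close>
    let ?c = "inv a' \<otimes> a" and ?d = "b' \<otimes> inv b"
    have c: "?c \<in> A" "?d \<in> B" using m by auto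
    \<comment> \<open>Translating by $a'$ and $b$ reduces the claim to $c^+ d^+ = c \vee d$.\<close>
    have "(a \<curlyvee> a') \<otimes> (b \<curlyvee> b') = a' \<otimes> (lpos ?c \<otimes> lpos ?d) \<otimes> b"
    proof -
      have "a \<curlyvee> a' = a' \<otimes> lpos ?c"
        using m by (simp add: lpos_def mult_ljoin_distrib flip: m_assoc)
      moreover have "b \<curlyvee> b' = lpos ?d \<otimes> b"
        using m by (simp add: lpos_def ljoin_mult_distrib m_assoc ljoin_comm)
      ultimately show ?thesis using m by (simp add: m_assoc)
    qed
    also have "\<dots> = a' \<otimes> (?c \<curlyvee> ?d) \<otimes> b"
      using orthogonal_ljoin[OF orth[OF c]] c by simp
    also have "\<dots> = (a \<otimes> b) \<curlyvee> (a' \<otimes> b')"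
      using m by (simp add: mult_ljoin_distrib ljoin_mult_distrib m_assoc)
        (simp flip: m_assoc)
    finally show ?thesis .
  qed
  have "?f \<in> lhom (lprod (X\<lparr>carrier := A\<rparr>) (X\<lparr>carrier := B\<rparr>)) X"
    by (auto simp: lhom_def hom_def lprod_def monoid.defs lgroup.defs DirProd_def mult join)
  then show ?thesis
    unfolding cooperate_def by (rule bexI[rotated]) auto
qed

text \<open>The meet is encoded by a join of inverses, so the cooperator is applied to the join of
  \<open>(inv (labs X a), \<one>)\<close> and \<open>(\<one>, inv (labs X b))\<close>. Absolute
  values are at least \<open>\<one>\<close>, so this join is the pair of units.\<close>

lemma cooperate_imp_orthogonal:
  assumes A: "subalgebra A X" and B: "subalgebra B X" and co: "cooperate X A B"
    and m: "a \<in> A" "b \<in> B"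
  shows "labs X a \<curlywedge> labs X b = \<one>"
proof -
  interpret A: subgroup A X using A by (simp add: subalgebra_def)
  interpret B: subgroup B X using B by (simp add: subalgebra_def)
  obtain f where
    f: "f \<in> lhom (lprod (X\<lparr>carrier := A\<rparr>) (X\<lparr>carrier := B\<rparr>)) X"
    and fA: "\<And>a. a \<in> A \<Longrightarrow> f (a, \<one>) = a" and fB: "\<And>b. b \<in> B \<Longrightarrow> f (\<one>, b) = b"
    using co unfolding cooperate_def by auto
  have join: "f (a \<curlyvee> a', b \<curlyvee> b') = f (a, b) \<curlyvee> f (a', b')"
    if "a \<in> A" "a' \<in> A" "b \<in> B" "b' \<in> B" for a b a' b'
    using f that by (auto simp: lhom_def lprod_def monoid.defs lgroup.defs DirProd_def)
  have l: "inv (labs X a) \<in> A" "inv (labs X b) \<in> B"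
    using A B m by (auto simp: subalgebra_labs)
  have le: "inv (labs X x) \<curlyvee> \<one> = \<one>" if "x \<in> carrier X" for x
    using inv_le_mono[OF one_le_labs[OF that]] that by (simp add: le_def)
  have "inv (labs X a) \<curlyvee> inv (labs X b) = f (inv (labs X a) \<curlyvee> \<one>, \<one> \<curlyvee> inv (labs X b))"
    using join[of "inv (labs X a)" \<one> \<one> "inv (labs X b)"] l by (simp add: fA fB)
  also have "\<dots> = \<one>"
    using m le[of a] le[of b] fA[of \<one>] by (simp add: ljoin_comm)
  finally show ?thesis by (simp add: lmeet_def)
qed

section \<open>Polars: convexity, closure and normality\<close>

text \<open>Membership is tested on an upper bound of \<open>labs X x\<close>; the bounds supplied
  later are products of absolute values of elements of the polar.\<close>

lemma polar_if_labs_le: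
  assumes "labs X x \<preceq> t" "\<And>s. s \<in> S \<Longrightarrow> t \<curlywedge> labs X s = \<one>" "S \<subseteq> carrier X"
    "x \<in> carrier X" "t \<in> carrier X"
  shows "x \<in> polar X S"
proof -
  have "labs X x \<curlywedge> labs X s = \<one>" if "s \<in> S" for s
    using that assms by (intro disjoint_mono[OF assms(2)[OF that]]) auto
  then show ?thesis using assms by (simp add: polar_def)
qed

lemma polar_mult_disjoint:
  assumes "x \<in> polar X S" "y \<in> polar X S" "s \<in> S" "S \<subseteq> carrier X"
  shows "(labs X x \<otimes> labs X y) \<curlywedge> labs X s = \<one>"
  using assms by (auto simp: polar_def intro!: disjoint_mult)

lemma labs_le_labs_mult:
  assumes "x \<in> carrier X" "y \<in> carrier X"
  shows "labs X x \<preceq> labs X x \<otimes> labs X y" "labs X y \<preceq> labs X x \<otimes> labs X y"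
  using assms by (auto intro: le_mult_left le_mult_right)

text \<open>Here \<open>x \<preceq> labs X b\<close> and
  \<open>inv x \<preceq> inv a \<preceq> labs X a\<close>, so
  \<open>labs X a \<otimes> labs X b\<close> bounds \<open>labs X x\<close>.\<close>

lemma polar_convex:
  assumes "a \<in> polar X S" "b \<in> polar X S" "a \<preceq> x" "x \<preceq> b" "x \<in> carrier X"
    and S: "S \<subseteq> carrier X"
  shows "x \<in> polar X S"
proof (rule polar_if_labs_le[OF _ polar_mult_disjoint[OF assms(1,2)]])
  have c: "a \<in> carrier X" "b \<in> carrier X" using assms by (auto simp: polar_def)
  have "x \<preceq> labs X b" using le_trans[OF assms(4) le_labs] c assms by simp
  moreover have "inv x \<preceq> labs X a"
    using le_trans[OF inv_le_mono[OF assms(3)] inv_le_labs] c assms by simp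
  ultimately show "labs X x \<preceq> labs X a \<otimes> labs X b"
    using c assms labs_le_labs_mult[of a b] le_trans[of x "labs X b"] le_trans[of "inv x" "labs X a"]
    by (intro labs_le) auto
qed (use assms in \<open>auto simp: polar_def\<close>)

text \<open>Inverses have the same absolute value. For \<open>x \<otimes> y\<close> the bound is the
  triple product of \<open>labs_of_mult_le\<close>, for \<open>x \<curlyvee> y\<close> it is
  \<open>labs X x \<otimes> labs X y\<close>.\<close>

lemma subalgebra_polar:
  assumes S: "S \<subseteq> carrier X"
  shows "subalgebra (polar X S) X"
  unfolding subalgebra_def
proof (intro conjI ballI subgroupI)
  show "polar X S \<subseteq> carrier X" by (auto simp: polar_def)
  have "\<one> \<in> polar X S"
    using S by (auto simp: polar_def intro!: lmeet_absorb)
  then show "polar X S \<noteq> {}" by auto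
next
  fix x assume "x \<in> polar X S"
  then show "inv x \<in> polar X S" by (auto simp: polar_def)
next
  fix x y assume xy: "x \<in> polar X S" "y \<in> polar X S"
  then have c: "x \<in> carrier X" "y \<in> carrier X" by (auto simp: polar_def)
  show "x \<otimes> y \<in> polar X S"
  proof (rule polar_if_labs_le[OF labs_of_mult_le[OF c] _ S])
    fix s assume "s \<in> S"
    with xy S show "(labs X x \<otimes> labs X y \<otimes> labs X x) \<curlywedge> labs X s = \<one>"
      using polar_mult_disjoint[OF xy, of s] le_trans[OF one_le_labs labs_le_labs_mult(1)[of x y]] c
      by (intro disjoint_mult) (auto simp: polar_def)
  qed (use c in auto)
  show "x \<curlyvee> y \<in> polar X S"
  proof (rule polar_if_labs_le[OF _ polar_mult_disjoint[OF xy]])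
    \<comment> \<open>Inverting \<open>x \<preceq> x \<curlyvee> y\<close> puts
      \<open>inv (x \<curlyvee> y)\<close> below \<open>inv x\<close>, so a single absolute value
      bounds it.\<close>
    have "inv (x \<curlyvee> y) \<preceq> labs X x"
      using le_trans[OF inv_le_mono[OF ljoin_ge1[of x y]] inv_le_labs] c by simp
    moreover have "x \<preceq> labs X x \<otimes> labs X y" "y \<preceq> labs X x \<otimes> labs X y"
      using c labs_le_labs_mult[of x y] le_trans[of x "labs X x"] le_trans[of y "labs X y"] by auto
    ultimately show "labs X (x \<curlyvee> y) \<preceq> labs X x \<otimes> labs X y"
      using c labs_le_labs_mult[of x y] le_trans[of "inv (x \<curlyvee> y)" "labs X x"]
      by (intro labs_le ljoin_least) auto
  qed (use c S in auto)
qed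

text \<open>Conjugation respects absolute values and meets. By normality each \<open>s\<close> in
  \<open>A\<close> is the conjugate by \<open>g\<close> of some \<open>?t\<close> in
  \<open>A\<close>, so the conjugation can be moved outside the meet.\<close>

lemma polar_normal:
  assumes A: "A \<lhd> X"
  shows "polar X A \<lhd> X"
proof (rule normal_invI)
  interpret A: normal A X by fact
  show "subgroup (polar X A) X"
    using subalgebra_polar[OF A.subset] by (simp add: subalgebra_def)
  fix g x assume g: "g \<in> carrier X" and x: "x \<in> polar X A"
  have xc: "x \<in> carrier X" using x by (auto simp: polar_def)
  have "labs X (g \<otimes> x \<otimes> inv g) \<curlywedge> labs X s = \<one>" if s: "s \<in> A" for s
  proof -
    let ?t = "inv g \<otimes> s \<otimes> g"
    have t: "?t \<in> A" using A.inv_op_closed1[OF g s] .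
    have "s = g \<otimes> ?t \<otimes> inv g" using g s by (simp add: m_assoc) (simp flip: m_assoc)
    then have "labs X s = g \<otimes> labs X ?t \<otimes> inv g"
      using labs_conj[OF g, of ?t] t by simp
    then have "labs X (g \<otimes> x \<otimes> inv g) \<curlywedge> labs X s = g \<otimes> (labs X x \<curlywedge> labs X ?t) \<otimes> inv g"
      using g xc t labs_conj[OF g xc] by (simp add: mult_lmeet_distrib lmeet_mult_distrib)
    then show ?thesis using x t g by (simp add: polar_def)
  qed
  then show "g \<otimes> x \<otimes> inv g \<in> polar X A" using g xc by (simp add: polar_def)
qed

section \<open>Quotients by convex normal subalgebras\<close>

text \<open>This makes the join well defined on right cosets. An element \<open>t\<close> of
  \<open>P\<close> above \<open>p\<close>, \<open>q\<close> and their inverses traps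
  \<open>p \<otimes> x \<curlyvee> q \<otimes> y\<close> between
  \<open>inv t \<otimes> (x \<curlyvee> y)\<close> and \<open>t \<otimes> (x \<curlyvee> y)\<close>.
  Cancelling \<open>x \<curlyvee> y\<close> leaves an element between \<open>inv t\<close> and
  \<open>t\<close>, so convexity applies.\<close>

lemma ljoin_mod_convex:
  assumes P: "subalgebra P X"
    and convex: "\<And>a b x. \<lbrakk>a \<in> P; b \<in> P; x \<in> carrier X; a \<preceq> x; x \<preceq> b\<rbrakk> \<Longrightarrow> x \<in> P"
    and p: "p \<in> P" "q \<in> P" and c: "x \<in> carrier X" "y \<in> carrier X"
  shows "(p \<otimes> x \<curlyvee> q \<otimes> y) \<otimes> inv (x \<curlyvee> y) \<in> P"
proof -
  interpret P: subgroup P X using P by (simp add: subalgebra_def)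
  define t where "t = labs X p \<curlyvee> labs X q"
  have t: "t \<in> P" using P p subalgebra_labs[OF P] by (auto simp: t_def subalgebra_def)
  have le: "p \<preceq> t" "q \<preceq> t" "inv p \<preceq> t" "inv q \<preceq> t"
    using p le_trans[OF le_labs[of p] ljoin_ge1[of _ "labs X q"]]
      le_trans[OF le_labs[of q] ljoin_ge2[of "labs X p"]]
      le_trans[OF inv_le_labs[of p] ljoin_ge1[of _ "labs X q"]]
      le_trans[OF inv_le_labs[of q] ljoin_ge2[of "labs X p"]] by (simp_all add: t_def)
  have ge: "inv t \<preceq> p" "inv t \<preceq> q"
    using inv_le_mono[OF le(3)] inv_le_mono[OF le(4)] p t by auto
  let ?u = "p \<otimes> x \<curlyvee> q \<otimes> y" and ?v = "x \<curlyvee> y"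
  have cl: "?u \<in> carrier X" "?v \<in> carrier X" "t \<in> carrier X" using c p t by auto
  have up: "?u \<preceq> t \<otimes> ?v"
    using le c p t by (intro ljoin_least mult_le_mono) auto
  have "inv t \<otimes> x \<preceq> ?u" "inv t \<otimes> y \<preceq> ?u"
    using c p t le_trans[OF mult_le_mono_right[OF ge(1), of x] ljoin_ge1[of _ "q \<otimes> y"]]
      le_trans[OF mult_le_mono_right[OF ge(2), of y] ljoin_ge2[of "p \<otimes> x"]] by simp_all
  then have lo: "inv t \<otimes> ?v \<preceq> ?u"
    using c p t by (auto simp: mult_ljoin_distrib intro!: ljoin_least)
  have "?u \<otimes> inv ?v \<preceq> t \<otimes> ?v \<otimes> inv ?v" "inv t \<otimes> ?v \<otimes> inv ?v \<preceq> ?u \<otimes> inv ?v"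
    by (intro mult_le_mono_right[OF up] mult_le_mono_right[OF lo] m_closed inv_closed cl)+
  moreover have "t \<otimes> ?v \<otimes> inv ?v = t" "inv t \<otimes> ?v \<otimes> inv ?v = inv t"
    using inv_solve_right' cl by auto
  ultimately have "inv t \<preceq> ?u \<otimes> inv ?v" "?u \<otimes> inv ?v \<preceq> t" by simp_all
  then show ?thesis
    by (rule convex[OF P.m_inv_closed[OF t] t m_closed[OF cl(1) inv_closed[OF cl(2)]]])
qed

lemma l_ideal_if_convex_normal:
  assumes P: "subalgebra P X" and N: "P \<lhd> X"
    and convex: "\<And>a b x. \<lbrakk>a \<in> P; b \<in> P; x \<in> carrier X; a \<preceq> x; x \<preceq> b\<rbrakk> \<Longrightarrow> x \<in> P"
  shows "l_ideal P X"
proof -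
  interpret P: normal P X by fact
  \<comment> \<open>Cosets are sets, so \<open>Q\<close> has the type that \<open>l_ideal\<close>
    asks for. The join of two cosets unites the cosets of all joins of representatives; by
    \<open>ljoin_mod_convex\<close> these all coincide, so the union is one coset.\<close>
  define Q :: "'a set lgroup" where "Q = monoid.extend (X Mod P)
    (lgroup.fields (\<lambda>S T. \<Union>s\<in>S. \<Union>t\<in>T. P #> (s \<curlyvee> t)))"
  have carr: "carrier Q = (\<lambda>x. P #> x) ` carrier X"
    by (auto simp: Q_def monoid.defs FactGroup_def RCOSETS_def)
  have mult: "(P #> x) \<otimes>\<^bsub>Q\<^esub> (P #> y) = P #> (x \<otimes> y)"
    if "x \<in> carrier X" "y \<in> carrier X" for x y
    using that by (simp add: Q_def monoid.defs FactGroup_def P.rcos_sum)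
  have one: "\<one>\<^bsub>Q\<^esub> = P" by (simp add: Q_def monoid.defs FactGroup_def)
  have join: "(P #> x) \<curlyvee>\<^bsub>Q\<^esub> (P #> y) = P #> (x \<curlyvee> y)"
    if c: "x \<in> carrier X" "y \<in> carrier X" for x y
  proof -
    have eq: "P #> (s \<curlyvee> t) = P #> (x \<curlyvee> y)" if st: "s \<in> P #> x" "t \<in> P #> y" for s t
    proof -
      obtain p q where pq: "p \<in> P" "q \<in> P" "s = p \<otimes> x" "t = q \<otimes> y"
        using st by (auto simp: r_coset_def)
      have "(s \<curlyvee> t) \<otimes> inv (x \<curlyvee> y) \<in> P"
        using ljoin_mod_convex[OF P convex pq(1,2) c] pq by simp
      moreover have "s \<curlyvee> t = (s \<curlyvee> t) \<otimes> inv (x \<curlyvee> y) \<otimes> (x \<curlyvee> y)"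
        using pq c by (simp add: m_assoc)
      ultimately have "s \<curlyvee> t \<in> P #> (x \<curlyvee> y)" by (auto simp: r_coset_def)
      then show ?thesis using repr_independence[of "s \<curlyvee> t" P "x \<curlyvee> y"] c P.subgroup_axioms by simp
    qed
    have "x \<in> P #> x" "y \<in> P #> y" using c rcos_self P.subgroup_axioms by auto
    then have "(\<Union>s\<in>P #> x. \<Union>t\<in>P #> y. P #> (s \<curlyvee> t)) = P #> (x \<curlyvee> y)" using eq by blast
    then show ?thesis by (simp add: Q_def monoid.defs lgroup.defs)
  qed
  \<comment> \<open>\<open>Q\<close> differs from the factor group only by the added join, so the
    group laws carry over.\<close>
  have "group Q"
    using P.factorgroup_is_group
    by (simp add: Q_def monoid.defs group_def monoid_def group_axioms_def Units_def)
  moreover have "S \<curlyvee>\<^bsub>Q\<^esub> T = T \<curlyvee>\<^bsub>Q\<^esub> S" if "S \<in> carrier Q" "T \<in> carrier Q" for S T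
    using that ljoin_comm by (auto simp only: carr join)
  \<comment> \<open>Every element of \<open>Q\<close> is the coset of some \<open>x\<close>, and
    both operations are computed on representatives, so the laws descend from
    \<open>X\<close>.\<close>
  ultimately have Q: "lattice_ordered_group Q"
    unfolding lattice_ordered_group_def lattice_ordered_group_axioms_def
    by (auto simp only: carr mult join m_closed ljoin_closed ljoin_assoc ljoin_idem
        mult_ljoin_distrib ljoin_mult_distrib)
  have h: "(\<lambda>x. P #> x) \<in> lhom X Q"
    by (auto simp: lhom_def hom_def carr mult join)
  have "P = kernel X Q (\<lambda>x. P #> x)"
    unfolding kernel_def one
    using coset_join1[OF _ _ P.subgroup_axioms] coset_join2[OF _ P.subgroup_axioms] P.subset
    by blast
  with P Q h show ?thesis unfolding l_ideal_def by blast
qed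

text \<open>A morphism is in particular a group homomorphism; this supplies the hypothesis of
  \<open>polar_normal\<close>.\<close>

lemma l_ideal_normal:
  assumes "l_ideal A X"
  shows "A \<lhd> X"
proof -
  obtain Y :: "'a set lgroup" and h where Y: "lattice_ordered_group Y" "h \<in> lhom X Y"
    and A: "A = kernel X Y h"
    using assms unfolding l_ideal_def by blast
  interpret Y: lattice_ordered_group Y by fact
  interpret h: group_hom X Y h by unfold_locales (use Y in \<open>simp add: lhom_def\<close>)
  show ?thesis unfolding A by (rule h.normal_kernel)
qed

section \<open>The polar as centralizer\<close>

lemma cooperate_iff_subset_polar:
  assumes A: "subalgebra A X" and B: "subalgebra B X"
  shows "cooperate X A B \<longleftrightarrow> B \<subseteq> polar X A"
proof
  assume "cooperate X A B"
  then have "labs X b \<curlywedge> labs X a = \<one>" if "a \<in> A" "b \<in> B" for a b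
    using that cooperate_imp_orthogonal[OF A B] subalgebra_subset[OF A] subalgebra_subset[OF B]
      lmeet_comm[of "labs X b" "labs X a"] by (auto simp: subset_iff)
  then show "B \<subseteq> polar X A" using subalgebra_subset[OF B] by (auto simp: polar_def)
next
  assume *: "B \<subseteq> polar X A"
  then have "labs X a \<curlywedge> labs X b = \<one>" if "a \<in> A" "b \<in> B" for a b
    using that subalgebra_subset[OF A] subalgebra_subset[OF B]
      lmeet_comm[of "labs X a" "labs X b"] by (auto simp: polar_def subset_iff)
  then show "cooperate X A B" by (rule cooperate_if_orthogonal[OF A B])
qed

end

theorem corollary3p8:
  fixes X :: "('a, 'm) lgroup_scheme" and A :: "'a set"
  assumes "lattice_ordered_group X" and "subalgebra A X"
  shows "(\<forall>B. subalgebra B X \<longrightarrow> (cooperate X A B \<longleftrightarrow> B \<subseteq> polar X A)) \<and>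
    is_centralizer X A (polar X A) \<and>
    (l_ideal A X \<longrightarrow> l_ideal (polar X A) X)"
proof -
  interpret lattice_ordered_group X by fact
  note sub = subalgebra_subset[OF assms(2)]
  note polar = subalgebra_polar[OF sub]
  have "l_ideal (polar X A) X" if "l_ideal A X"
    using l_ideal_if_convex_normal[OF polar polar_normal[OF l_ideal_normal[OF that]]]
      polar_convex sub by blast
  \<comment> \<open>Taking \<open>B\<close> to be the polar itself, the equivalence yields
    cooperation; for arbitrary \<open>B\<close> it yields maximality.\<close>
  then show ?thesis
    using cooperate_iff_subset_polar[OF assms(2)] polar by (auto simp: is_centralizer_def)
qed

end
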